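(* For every $H\in\mathbb{R}$, the family $\{\Sigma^-_{H,c}\}_{c_H<c<0}$ of $T$-axisymmetric spacelike spherically symmetric constant mean curvature hypersurfaces forms a foliation of the part of region II of the Kruskal extension lying between $r=0$ and the cylindrical hypersurface $r=r_H$. That is, the hypersurfaces $\Sigma^-_{H,c}$, $c\in(c_H,0)$, are pairwise disjoint, and their union is $\{(U,V): U<0,\ V>0,\ 0<r(U,V)<r_H\}$.
   Context: Fix $M>0$ and put $h(r)=1-\frac{2M}{r}$. The Kruskal extension of the Schwarzschild spacetime is $\{(U,V)\in\mathbb{R}^2: UV>-2M\}\times S^2$ with metric $\frac{16M^2e^{-r/(2M)}}{r}\,dU\,dV+r^2(d\theta^2+\sin^2\theta\,d\phi^2)$, where $r=r(U,V)>0$ is determined by $(r-2M)e^{r/(2M)}=UV$. Region II is $\{U<0,V>0\}$; there the Schwarzschild time is $t=2M\ln|V/U|$. Spherically symmetric hypersurfaces are identified with curves in the $(U,V)$-plane; such a curve is $T$-axisymmetric if it is invariant under $\rho(U,V)=(-V,-U)$. For $H\in\mathbb{R}$ let $k_H(r)=-Hr^3-r^{3/2}(2M-r)^{1/2}$ on $(0,2M)$. It has a unique minimum point $r_H\in(0,2M)$, with minimum value $c_H=k_H(r_H)<0$; it is strictly decreasing on $(0,r_H]$ (with limit $0$ at $r=0$) and strictly increasing on $[r_H,2M)$. For $c\in(c_H,0)$ let $r^-_{H,c}\in(0,r_H)$ be the solution of $k_H(r)=c$ in $(0,r_H)$, and for $r\in(0,r^-_{H,c}]$ let $$f(r;H,c)=\int_{r^-_{H,c}}^{r}\frac{x}{x-2M}\,\frac{-Hx^3-c}{\sqrt{(Hx^3+c)^2+x^3(x-2M)}}\,dx\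 (\ge 0).$$ The hypersurface $\Sigma^-_{H,c}$ (which is spacelike, of constant mean curvature $H$, $T$-axisymmetric and contained in region II) is the union of the curve $$U(r;c)=-e^{-\frac1{4M}(f(r;H,c)-r-2M\ln|r-2M|)},\quad V(r;c)=e^{\frac1{4M}(f(r;H,c)+r+2M\ln|r-2M|)},\quad 0<r\le r^-_{H,c},$$ (the part in $U+V\ge 0$) and its image under $\rho$. *)

theory Defs
  imports "HOL-Analysis.Analysis"
begin

text \<open>
  The Kruskal extension of Schwarzschild spacetime of mass \<open>M > 0\<close> is the product of a domain in
  the \<open>(U,V)\<close>-plane with the two-sphere.  A spherically symmetric subset is the product of a planar
  set with the sphere, and is represented throughout by that planar set.
\<close>

definition kruskal :: "real \<Rightarrow> (real \<times> real) set" where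
  "kruskal M = {(U, V). U * V > - 2 * M}"

text \<open>The equation has a unique positive solution only on \<^term>\<open>kruskal M\<close>, so this
  function is meaningful only there.\<close>

definition area_radius :: "real \<Rightarrow> real \<times> real \<Rightarrow> real" where
  "area_radius M = (\<lambda>(U, V). THE r. r > 0 \<and> (r - 2 * M) * exp (r / (2 * M)) = U * V)"

definition region_II :: "real \<Rightarrow> (real \<times> real) set" where
  "region_II M = {(U, V) \<in> kruskal M. U < 0 \<and> V > 0}"

definition T_refl :: "real \<times> real \<Rightarrow> real \<times> real" where
  "T_refl = (\<lambda>(U, V). (- V, - U))"

definition k_fun :: "real \<Rightarrow> real \<Rightarrow> real \<Rightarrow> real" where
  "k_fun M H r = - H * r ^ 3 - r powr (3/2) * (2 * M - r) powr (1/2)"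

definition r_min :: "real \<Rightarrow> real \<Rightarrow> real" where
  "r_min M H = (THE r. is_arg_min (k_fun M H) (\<lambda>x. x \<in> {0<..<2 * M}) r)"

definition c_min :: "real \<Rightarrow> real \<Rightarrow> real" where
  "c_min M H = k_fun M H (r_min M H)"

definition r_minus :: "real \<Rightarrow> real \<Rightarrow> real \<Rightarrow> real" where
  "r_minus M H c = (THE r. r \<in> {0<..<r_min M H} \<and> k_fun M H r = c)"

text \<open>The integral runs from \<^term>\<open>r_minus M H c\<close> down to \<open>r \<le> r_minus M H c\<close>; the
  interval integral is oriented, so the sign is the usual one.  The integrand has an integrable
  inverse square root singularity at \<^term>\<open>r_minus M H c\<close>.\<close>

definition f_height :: "real \<Rightarrow> real \<Rightarrow> real \<Rightarrow> real \<Rightarrow> real" where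
  "f_height M H c r =
     (LBINT x=ereal (r_minus M H c)..ereal r.
        x / (x - 2 * M) * ((- H * x ^ 3 - c) / sqrt ((H * x ^ 3 + c)\<^sup>2 + x ^ 3 * (x - 2 * M))))"

definition U_curve :: "real \<Rightarrow> real \<Rightarrow> real \<Rightarrow> real \<Rightarrow> real" where
  "U_curve M H c r = - exp (- (1 / (4 * M)) * (f_height M H c r - r - 2 * M * ln \<bar>r - 2 * M\<bar>))"

definition V_curve :: "real \<Rightarrow> real \<Rightarrow> real \<Rightarrow> real \<Rightarrow> real" where
  "V_curve M H c r = exp (1 / (4 * M) * (f_height M H c r + r + 2 * M * ln \<bar>r - 2 * M\<bar>))"

definition half_curve :: "real \<Rightarrow> real \<Rightarrow> real \<Rightarrow> (real \<times> real) set" where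
  "half_curve M H c = (\<lambda>r. (U_curve M H c r, V_curve M H c r)) ` {0<..r_minus M H c}"

definition Sigma_minus :: "real \<Rightarrow> real \<Rightarrow> real \<Rightarrow> (real \<times> real) set" where
  "Sigma_minus M H c = half_curve M H c \<union> T_refl ` half_curve M H c"

end

theory Submission
  imports Defs
begin

text \<open>
  In the coordinates \<open>(r, t)\<close> on region II, \<open>Sigma_minus M H c\<close> is the set \<open>\<bar>t\<bar> = f(r; c)\<close>, so it has to be
  shown that for fixed \<open>r\<close> the height \<open>f(r; c)\<close> increases strictly and continuously from \<open>0\<close> to
  infinity as \<open>c\<close> decreases from \<open>k(r)\<close> to the minimal value of \<open>k\<close>.  Monotonicity is not visible in the
  integral defining \<open>f\<close>: when \<open>c\<close> decreases, the integrand decreases while the interval grows.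
  Put \<open>e = - c\<close>, \<open>W(x) = sqrt (x\<^sup>3 (2M - x))\<close>, and take \<open>p = (e - H x\<^sup>3) / W(x)\<close> as the new variable of
  integration, followed by \<open>p = sqrt (1 + w\<^sup>2)\<close>, which absorbs the factor \<open>p / sqrt (p\<^sup>2 - 1)\<close>.
  Then \<open>f(r; c)\<close> is the integral from \<open>0\<close> to \<open>w(r, e)\<close> of \<open>G(p, X(p, e))\<close>, where
  \<open>G(p, x) = sqrt (x / (2M - x)) / (3 H + p R(x))\<close>, \<open>R(x) = (3M - 2x) / W(x)\<close>, and \<open>x = X(p, e)\<close> solves
  \<open>H x\<^sup>3 + p W(x) = e\<close>.  Since \<open>R\<close> is decreasing, \<open>G\<close> increases with \<open>x\<close>; both the integrand and the upper
  limit therefore increase with \<open>e\<close>, and the integrand is regular at the end point \<open>w = 0\<close>.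
  Divergence comes from the double zero of \<open>k - c\<close> in the limit, by comparison with a logarithm.
\<close>

section \<open>The critical radius and the level curves\<close>

locale schwarzschild =
  fixes M H :: real
  assumes M_pos: "M > 0"
begin

definition W :: "real \<Rightarrow> real" where "W x = sqrt (x ^ 3 * (2 * M - x))"

text \<open>This is the derivative of \<open>W\<close> divided by \<open>x\<^sup>2\<close>. With
  that factor split off, the slope of \<open>K p\<close> has the sign of
  \<open>3 * H + p * R x\<close>, and since \<open>R\<close> decreases, \<open>K p\<close> has at
  most one critical point in \<open>(0, 2 * M)\<close> for \<open>p > 0\<close>.\<close>

definition R :: "real \<Rightarrow> real" where "R x = (3 * M - 2 * x) / W x"

text \<open>\<open>k_fun M H\<close> is \<open>- K 1\<close>; the levels of \<open>K p\<close> for \<open>p > 1\<close> arise in the change of variable.\<close>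

definition K :: "real \<Rightarrow> real \<Rightarrow> real" where "K p x = H * x ^ 3 + p * W x"

lemma W_pos: "0 < x \<Longrightarrow> x < 2 * M \<Longrightarrow> W x > 0"
  by (simp add: W_def)

lemma W_sq: "0 < x \<Longrightarrow> x < 2 * M \<Longrightarrow> (W x)\<^sup>2 = x ^ 3 * (2 * M - x)"
  by (simp add: W_def)

lemma k_fun_eq: "0 < x \<Longrightarrow> x < 2 * M \<Longrightarrow> k_fun M H x = - K 1 x"
proof -
  assume x: "0 < x" "x < 2 * M"
  have "x powr (3/2) = (x powr 3) powr (1/2)"
    by (simp add: powr_powr)
  also have "\<dots> = sqrt (x ^ 3)"
    using x by (simp add: powr_half_sqrt)
  finally have "x powr (3/2) = sqrt (x ^ 3)" .
  with x show ?thesis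
    by (simp add: k_fun_def K_def W_def powr_half_sqrt real_sqrt_mult)
qed

lemma continuous_on_W: "continuous_on A W"
  unfolding W_def by (intro continuous_intros)

lemma continuous_on_K: "continuous_on A (K p)"
  unfolding K_def by (intro continuous_intros continuous_on_W)

lemma DERIV_W:
  assumes "0 < x" "x < 2 * M"
  shows "(W has_real_derivative x\<^sup>2 * R x) (at x)"
proof -
  have pos: "0 < x ^ 3 * (2 * M - x)" using assms by simp
  let ?g = "\<lambda>x. x ^ 3 * (2 * M - x)"
  have "(?g has_real_derivative (3 * x\<^sup>2) * (2 * M - x) + (- 1) * x ^ 3) (at x)"
    by (rule derivative_eq_intros refl | simp)+
  moreover have "(3 * x\<^sup>2) * (2 * M - x) + (- 1) * x ^ 3 = 2 * (x\<^sup>2 * (3 * M - 2 * x))"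
    by algebra
  ultimately have "(?g has_real_derivative 2 * (x\<^sup>2 * (3 * M - 2 * x))) (at x)"
    by (simp only:)
  from DERIV_chain2 [where f = sqrt and g = ?g, OF DERIV_real_sqrt [OF pos] this]
  have "(W has_real_derivative inverse (W x) / 2 * (2 * (x\<^sup>2 * (3 * M - 2 * x)))) (at x)"
    by (simp only: W_def [abs_def])
  moreover have "inverse (W x) / 2 * (2 * (x\<^sup>2 * (3 * M - 2 * x))) = x\<^sup>2 * R x"
    by (simp only: R_def divide_inverse) simp
  ultimately show ?thesis by (simp only:)
qed

text \<open>Minus a sum of nonnegative terms: the sign gives the monotonicity of \<open>R\<close>,
  and boundedness on compact intervals gives the quadratic estimate near \<open>rH\<close>.\<close>

lemma DERIV_R:
  assumes "0 < x" "x < 2 * M"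
  shows "(R has_real_derivative - (2 / W x + (x * (3 * M - 2 * x))\<^sup>2 / W x ^ 3)) (at x)"
proof -
  have pos: "W x > 0" using assms by (rule W_pos)
  have "((\<lambda>x. (3 * M - 2 * x) / W x) has_real_derivative
      ((- 2) * W x - (3 * M - 2 * x) * (x\<^sup>2 * R x)) / (W x * W x)) (at x)"
    by (rule derivative_eq_intros DERIV_W assms refl)+ (use pos in auto)
  moreover have "((- 2) * W x - (3 * M - 2 * x) * (x\<^sup>2 * R x)) / (W x * W x)
      = - (2 / W x + (x * (3 * M - 2 * x))\<^sup>2 / W x ^ 3)"
    using pos by (simp add: R_def field_simps power2_eq_square power3_eq_cube)
  ultimately show ?thesis by (simp add: R_def [abs_def])
qed

lemma R_strict_antimono:
  assumes "0 < x" "x < y" "y < 2 * M"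
  shows "R y < R x"
proof (rule DERIV_neg_imp_decreasing [OF \<open>x < y\<close>])
  fix z assume z: "x \<le> z" "z \<le> y"
  with assms have z': "0 < z" "z < 2 * M" by auto
  have "2 / W z + (z * (3 * M - 2 * z))\<^sup>2 / W z ^ 3 > 0"
    using W_pos [OF z'] by (intro add_pos_nonneg) auto
  then show "\<exists>d. (R has_real_derivative d) (at z) \<and> d < 0"
    using DERIV_R [OF z'] by fastforce
qed

lemma DERIV_K:
  assumes "0 < x" "x < 2 * M"
  shows "(K p has_real_derivative x\<^sup>2 * (3 * H + p * R x)) (at x)"
  unfolding K_def
  by (rule derivative_eq_intros DERIV_W assms refl)+ (simp add: algebra_simps)

lemma K_increasing:
  assumes "0 \<le> x" "x < y" "y < 2 * M" "p > 0" "3 * H + p * R y \<ge> 0"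
  shows "K p x < K p y"
proof (rule DERIV_pos_imp_increasing_open [OF \<open>x < y\<close>])
  fix z assume z: "x < z" "z < y"
  have z': "0 < z" "z < 2 * M" using assms z by auto
  have "p * R y < p * R z"
    using R_strict_antimono [of z y] z z' assms by (auto intro!: mult_strict_left_mono)
  with assms have "3 * H + p * R z > 0" by linarith
  with z' have "z\<^sup>2 * (3 * H + p * R z) > 0" by simp
  then show "\<exists>d. (K p has_real_derivative d) (at z) \<and> d > 0"
    using DERIV_K [OF z'] by blast
qed (rule continuous_on_K)

lemma K_decreasing:
  assumes "0 < x" "x < y" "y < 2 * M" "p > 0" "3 * H + p * R x \<le> 0"
  shows "K p y < K p x"
proof (rule DERIV_neg_imp_decreasing_open [OF \<open>x < y\<close>])
  fix z assume z: "x < z" "z < y"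
  have z': "0 < z" "z < 2 * M" using assms z by auto
  have "p * R z < p * R x"
    using R_strict_antimono [of x z] z z' assms by (auto intro!: mult_strict_left_mono)
  with assms have "3 * H + p * R z < 0" by linarith
  with z' have "z\<^sup>2 * (3 * H + p * R z) < 0" by (intro mult_pos_neg) auto
  then show "\<exists>d. (K p has_real_derivative d) (at z) \<and> d < 0"
    using DERIV_K [OF z'] by blast
qed (rule continuous_on_K)

lemma K_0 [simp]: "K p 0 = 0"
  by (simp add: K_def W_def)

abbreviation "rH \<equiv> r_min M H"

abbreviation "eH \<equiv> K 1 rH"

text \<open>Multiplying \<open>3 * H + R x\<close> by \<open>W x\<close> removes the blow-up at both
  ends. The product \<open>N\<close> is continuous with end values \<open>3 * M\<close> and
  \<open>- M\<close>, so it has a zero strictly inside.\<close>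

lemma exists_critical_point: "\<exists>x. 0 < x \<and> x < 2 * M \<and> 3 * H + R x = 0"
proof -
  define N where "N x = 3 * H * W x + 3 * M - 2 * x" for x
  have W0: "W 0 = 0" "W (2 * M) = 0" by (auto simp: W_def)
  have "\<exists>x\<ge>0. x \<le> 2 * M \<and> N x = 0"
    using M_pos by (intro IVT2')
      (auto simp: N_def W0 intro!: continuous_intros continuous_on_W)
  then obtain x where x: "0 \<le> x" "x \<le> 2 * M" "N x = 0" by blast
  have "x \<noteq> 0" "x \<noteq> 2 * M" using x(3) W0 M_pos by (auto simp: N_def)
  with x have x': "0 < x" "x < 2 * M" by auto
  with x W_pos [OF x'] have "3 * H + R x = 0"
    by (simp add: N_def R_def field_simps)
  with x' show ?thesis by blast
qed

lemma rH_props: "0 < rH" "rH < 2 * M" "3 * H + R rH = 0"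
proof -
  obtain x0 where x0: "0 < x0" "x0 < 2 * M" "3 * H + R x0 = 0"
    using exists_critical_point by blast
  \<comment> \<open>\<open>K 1\<close> increases strictly up to \<open>x0\<close> and decreases
    strictly after it, so \<open>x0\<close> is the only minimiser and the description in
    \<open>r_min\<close> is resolved.\<close>
  have less: "k_fun M H x0 < k_fun M H x" if "0 < x" "x < 2 * M" "x \<noteq> x0" for x
    using that x0(1,2) K_increasing [of x x0 1] K_decreasing [of x0 x 1] x0(3)
    by (cases "x < x0") (simp_all add: k_fun_eq)
  have "rH = x0"
    unfolding r_min_def
  proof (rule the_equality)
    show "is_arg_min (k_fun M H) (\<lambda>x. x \<in> {0<..<2 * M}) x0"
      using x0 less by (force simp: is_arg_min_def)
    show "x = x0" if "is_arg_min (k_fun M H) (\<lambda>x. x \<in> {0<..<2 * M}) x" for x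
      using that x0 less [of x] by (auto simp: is_arg_min_def)
  qed
  with x0 show "0 < rH" "rH < 2 * M" "3 * H + R rH = 0" by simp_all
qed

lemma c_min_eq: "c_min M H = - eH"
  unfolding c_min_def by (rule k_fun_eq [OF rH_props(1,2)])

lemma K_mono_p: "0 < x \<Longrightarrow> x < 2 * M \<Longrightarrow> p \<le> p' \<Longrightarrow> K p x \<le> K p' x"
  using W_pos [of x] by (simp add: K_def)

text \<open>Past a critical point \<open>K p\<close> decreases, so it could not get back above \<open>eH\<close> at \<open>rH\<close>.\<close>

lemma slope_pos:
  assumes "0 < x" "x < rH" "p \<ge> 1" "K p x < eH"
  shows "3 * H + p * R x > 0"
proof (rule ccontr)
  assume "\<not> ?thesis"
  then have "K p rH < K p x" using K_decreasing [of x rH p] assms rH_props by simp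
  moreover have "eH \<le> K p rH" using assms rH_props by (intro K_mono_p)
  ultimately show False using assms by simp
qed

lemma K_less:
  assumes "0 \<le> x" "x < y" "y < rH" "p \<ge> 1" "K p y < eH"
  shows "K p x < K p y"
  using K_increasing [of x y p] slope_pos [of y p] assms rH_props by simp

text \<open>At \<open>p = 1\<close> the slope vanishes exactly at \<open>rH\<close>, so monotonicity
  extends to \<open>y = rH\<close> with no condition on the level, unlike in
  \<open>K_less\<close>.\<close>

lemma K_1_less: "0 \<le> x \<Longrightarrow> x < y \<Longrightarrow> y \<le> rH \<Longrightarrow> K 1 x < K 1 y"
proof -
  assume *: "0 \<le> x" "x < y" "y \<le> rH"
  have "R rH \<le> R y"
    using R_strict_antimono [of y rH] * rH_props by (cases "y = rH") auto
  then show ?thesis using * K_increasing [of x y 1] rH_props by simp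
qed

section \<open>Solving \<open>K p x = e\<close> for \<open>x\<close> below \<open>rH\<close>\<close>

definition X :: "real \<Rightarrow> real \<Rightarrow> real" where
  "X p e = (THE x. 0 < x \<and> x < rH \<and> K p x = e)"

text \<open>For \<open>H > 0\<close> and \<open>p > 1\<close> the critical point of
  \<open>K p\<close> lies to the left of \<open>rH\<close>, so \<open>K p\<close> is not injective
  on \<open>(0, rH)\<close>. Injectivity holds below the level \<open>eH\<close>, which is where
  \<open>e < eH\<close> enters.\<close>

lemma X_eqI:
  assumes "0 < x" "x < rH" "K p x = e" "p \<ge> 1" "e < eH"
  shows "X p e = x"
  unfolding X_def
proof (rule the_equality)
  fix y assume "0 < y \<and> y < rH \<and> K p y = e"
  then show "y = x"
    using K_less [of x y p] K_less [of y x p] assms by (cases x y rule: linorder_cases) auto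
qed (use assms in auto)

lemma X_props:
  assumes "p \<ge> 1" "0 < e" "e < eH"
  shows "0 < X p e" "X p e < rH" "K p (X p e) = e"
proof -
  have "eH \<le> K p rH" using assms rH_props by (intro K_mono_p)
  then have "\<exists>x\<ge>0. x \<le> rH \<and> K p x = e"
    using assms rH_props by (intro IVT') (auto intro: continuous_on_K)
  then obtain x where x: "0 \<le> x" "x \<le> rH" "K p x = e" by blast
  have "x \<noteq> 0" "x \<noteq> rH" using x(3) assms \<open>eH \<le> K p rH\<close> by auto
  with x have x': "0 < x" "x < rH" by auto
  with x X_eqI assms have "X p e = x" by blast
  with x x' show "0 < X p e" "X p e < rH" "K p (X p e) = e" by auto
qed

lemma X_less_2M: "p \<ge> 1 \<Longrightarrow> 0 < e \<Longrightarrow> e < eH \<Longrightarrow> X p e < 2 * M"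
  using X_props(2) [of p e] rH_props(2) by simp

lemma less_X_iff:
  assumes "p \<ge> 1" "0 < e" "e < eH" "0 < x" "x < rH"
  shows "x < X p e \<longleftrightarrow> K p x < e"
  using K_less [of x "X p e" p] K_less [of "X p e" x p] X_props [of p e] assms
  by (cases x "X p e" rule: linorder_cases) auto

lemma X_less_iff:
  assumes "p \<ge> 1" "0 < e" "e < eH" "0 < x" "x < rH"
  shows "X p e < x \<longleftrightarrow> e < K p x"
proof -
  have "K p x = e \<longleftrightarrow> X p e = x"
    using X_eqI [of x p e] X_props(3) [of p e] assms by metis
  then show ?thesis using less_X_iff [of p e x] assms by argo
qed

lemma X_strict_mono:
  assumes "p \<ge> 1" "0 < e" "e < e'" "e' < eH"
  shows "X p e < X p e'"
  using less_X_iff [of p e' "X p e"] X_props [of p e] assms by auto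

text \<open>For fixed \<open>a\<close> in \<open>(0, rH)\<close>, the conditions
  \<open>a < X p e\<close> and \<open>X p e < a\<close> are strict inequalities between
  \<open>K p a\<close> and \<open>e\<close>, hence open in \<open>(p, e)\<close>. Other values of
  \<open>a\<close> are settled by the range of \<open>X\<close>.\<close>

lemma continuous_on_X: "continuous_on ({1..} \<times> {0<..<eH}) (\<lambda>z. X (fst z) (snd z))"
  unfolding continuous_on
proof
  let ?D = "{1..} \<times> {0<..<eH} :: (real \<times> real) set"
  fix z assume z: "z \<in> ?D"
  let ?F = "at z within ?D"
  have dom: "eventually (\<lambda>z'. z' \<in> ?D) ?F" by (simp add: eventually_at_filter)
  have lim: "((\<lambda>z'. K (fst z') a - snd z') \<longlongrightarrow> K (fst z) a - snd z) ?F" for a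
    unfolding K_def
    by (intro tendsto_diff tendsto_add tendsto_mult tendsto_const tendsto_fst tendsto_snd
        tendsto_ident_at)
  show "((\<lambda>z. X (fst z) (snd z)) \<longlongrightarrow> X (fst z) (snd z)) ?F"
  proof (rule order_tendstoI)
    fix a assume a: "a < X (fst z) (snd z)"
    show "eventually (\<lambda>z. a < X (fst z) (snd z)) ?F"
    proof (cases "a > 0")
      case False
      from dom show ?thesis
        by (rule eventually_mono) (use False in \<open>auto intro!: le_less_trans [OF _ X_props(1)]\<close>)
    next
      case True
      have "a < rH" using a X_props(2) [of "fst z" "snd z"] z by auto
      then have "K (fst z) a - snd z < 0" using a z True by (auto simp: less_X_iff)
      from order_tendstoD(2) [OF lim this] dom show ?thesis
        by eventually_elim (use True \<open>a < rH\<close> in \<open>auto simp: less_X_iff\<close>)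
    qed
  next
    fix a assume a: "X (fst z) (snd z) < a"
    show "eventually (\<lambda>z. X (fst z) (snd z) < a) ?F"
    proof (cases "a < rH")
      case False
      from dom show ?thesis
        by (rule eventually_mono) (use False in \<open>auto intro!: less_le_trans [OF X_props(2)]\<close>)
    next
      case True
      have "0 < a" using a X_props(1) [of "fst z" "snd z"] z by auto
      then have "K (fst z) a - snd z > 0" using a z True by (auto simp: X_less_iff)
      from order_tendstoD(1) [OF lim this] dom show ?thesis
        by eventually_elim (use True \<open>0 < a\<close> in \<open>auto simp: X_less_iff\<close>)
    qed
  qed
qed

lemma r_minus_eq:
  assumes "c_min M H < c" "c < 0"
  shows "r_minus M H c = X 1 (- c)"
proof -
  have "r \<in> {0<..<rH} \<and> k_fun M H r = c \<longleftrightarrow> 0 < r \<and> r < rH \<and> K 1 r = - c" for r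
    using rH_props by (auto simp: k_fun_eq)
  then show ?thesis by (simp add: r_minus_def X_def)
qed

section \<open>The height function in the variable w\<close>

definition G :: "real \<Rightarrow> real \<Rightarrow> real" where
  "G p x = sqrt (x / (2 * M - x)) / (3 * H + p * R x)"

lemma G_less:
  assumes "0 < x" "x < y" "y < 2 * M" "p > 0" "3 * H + p * R y > 0"
  shows "G p x < G p y"
proof -
  have "p * R y < p * R x"
    using assms R_strict_antimono [of x y] by (auto intro!: mult_strict_left_mono)
  moreover have "x / (2 * M - x) < y / (2 * M - y)"
    using assms M_pos by (intro frac_less) auto
  moreover from calculation assms have "3 * H + p * R x > 0" by linarith
  ultimately show ?thesis
    unfolding G_def using assms by (intro frac_less) auto
qed

definition g :: "real \<Rightarrow> real \<Rightarrow> real" where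
  "g e w = G (sqrt (1 + w\<^sup>2)) (X (sqrt (1 + w\<^sup>2)) e)"

lemma slope_X_pos:
  assumes "p \<ge> 1" "0 < e" "e < eH"
  shows "3 * H + p * R (X p e) > 0"
  using slope_pos [of "X p e" p] X_props [of p e] assms by simp

lemma g_strict_mono:
  assumes "0 < e" "e < e'" "e' < eH"
  shows "g e w < g e' w"
  unfolding g_def
  using assms by (intro G_less X_strict_mono slope_X_pos X_props X_less_2M)
    (auto simp: add_pos_nonneg)

lemma g_pos:
  assumes "0 < e" "e < eH"
  shows "g e w > 0"
  unfolding g_def G_def
  using assms slope_X_pos [of "sqrt (1 + w\<^sup>2)" e] X_props(1) [of "sqrt (1 + w\<^sup>2)" e]
    X_less_2M [of "sqrt (1 + w\<^sup>2)" e]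
  by (intro divide_pos_pos) auto

lemma continuous_on_R: "continuous_on {0<..<2 * M} R"
  by (intro continuous_at_imp_continuous_on ballI DERIV_isCont [OF DERIV_R]) auto

lemma continuous_on_g: "continuous_on ({0<..<eH} \<times> UNIV) (\<lambda>z. g (fst z) (snd z))"
proof -
  let ?D = "{0<..<eH} \<times> (UNIV :: real set)"
  have X: "continuous_on ?D (\<lambda>z. X (sqrt (1 + (snd z)\<^sup>2)) (fst z))"
    by (rule continuous_on_compose2
          [OF continuous_on_X, of _ "\<lambda>z. (sqrt (1 + (snd z)\<^sup>2), fst z)", simplified])
       (auto intro!: continuous_intros)
  have X_bounds: "0 < X (sqrt (1 + (snd z)\<^sup>2)) (fst z)" "X (sqrt (1 + (snd z)\<^sup>2)) (fst z) < 2 * M"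
    if "z \<in> ?D" for z
    using X_props(1) X_less_2M that by auto
  have R: "continuous_on ?D (\<lambda>z. R (X (sqrt (1 + (snd z)\<^sup>2)) (fst z)))"
    by (rule continuous_on_compose2 [OF continuous_on_R X]) (use X_bounds in auto)
  have "2 * M - X (sqrt (1 + (snd z)\<^sup>2)) (fst z) \<noteq> 0"
    "3 * H + sqrt (1 + (snd z)\<^sup>2) * R (X (sqrt (1 + (snd z)\<^sup>2)) (fst z)) \<noteq> 0"
    if "z \<in> ?D" for z
    using that X_bounds [OF that] slope_X_pos [of "sqrt (1 + (snd z)\<^sup>2)" "fst z"] by auto
  then show ?thesis
    unfolding g_def G_def
    by (intro continuous_on_divide continuous_on_real_sqrt continuous_on_diff continuous_on_add
        continuous_on_mult continuous_on_const continuous_on_power continuous_on_snd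
        continuous_on_id X R ballI)
qed

lemma continuous_on_g_e: "0 < e \<Longrightarrow> e < eH \<Longrightarrow> continuous_on A (g e)"
  by (rule continuous_on_compose2 [OF continuous_on_g, of _ "\<lambda>w. (e, w)", simplified])
     (auto intro!: continuous_on_Pair continuous_on_const continuous_on_id)

definition T :: "real \<Rightarrow> real \<Rightarrow> real" where
  "T e w = integral {0..w} (g e)"

lemma T_0 [simp]: "T e 0 = 0"
  by (simp add: T_def)

text \<open>Rescaling to a fixed interval turns joint continuity into that of a parameter integral.\<close>

lemma T_scaled:
  assumes "0 < e" "e < eH" "w \<ge> 0"
  shows "T e w = w * integral {0..1} (\<lambda>s. g e (w * s))"
proof (cases "w = 0")
  case False
  then have w: "w > 0" using assms by simp
  have "(g e has_integral T e w) (cbox 0 w)"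
    unfolding T_def using continuous_on_g_e [OF assms(1,2)]
    by (auto intro!: integrable_integral integrable_continuous_real)
  from has_integral_affinity' [OF this w, of 0] w
  have "((\<lambda>s. g e (w * s)) has_integral T e w / w) {0..1}"
    by (simp add: field_simps)
  then show ?thesis using w by (simp add: integral_unique)
qed simp

lemma continuous_on_T: "continuous_on ({0<..<eH} \<times> {0..}) (\<lambda>z. T (fst z) (snd z))"
proof -
  let ?D = "{0<..<eH} \<times> {0..} :: (real \<times> real) set"
  have "continuous_on (?D \<times> cbox 0 1) (\<lambda>(z, s). g (fst z) (snd z * s))"
    unfolding case_prod_beta
    by (rule continuous_on_compose2 [OF continuous_on_g, of _
          "\<lambda>y. (fst (fst y), snd (fst y) * snd y)", simplified])
       (auto intro!: continuous_on_Pair continuous_on_mult continuous_on_fst continuous_on_snd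
          continuous_on_id)
  then have "continuous_on ?D (\<lambda>z. integral (cbox 0 1) (\<lambda>s. g (fst z) (snd z * s)))"
    by (rule integral_continuous_on_param)
  then have "continuous_on ?D (\<lambda>z. snd z * integral {0..1} (\<lambda>s. g (fst z) (snd z * s)))"
    unfolding cbox_interval
    by (intro continuous_on_mult continuous_on_snd continuous_on_id)
  then show ?thesis
    by (rule continuous_on_eq) (auto simp: T_scaled)
qed

lemma DERIV_T:
  assumes "0 < e" "e < eH" "0 < w"
  shows "(T e has_real_derivative g e w) (at w)"
proof -
  have "(T e has_real_derivative g e w) (at w within {0..w + 1})"
    unfolding T_def [abs_def]
    using assms by (intro integral_has_real_derivative continuous_on_g_e) auto
  then show ?thesis using assms by (simp add: at_within_Icc_at)
qed

lemma T_mono_e: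
  assumes "0 < e" "e < e'" "e' < eH"
  shows "T e w \<le> T e' w"
  unfolding T_def
proof (rule integral_le)
  show "g e integrable_on {0..w}" "g e' integrable_on {0..w}"
    using assms by (auto intro!: integrable_continuous_real continuous_on_g_e)
  show "g e s \<le> g e' s" for s
    using g_strict_mono assms by (simp add: less_imp_le)
qed

lemma T_strict_mono_w:
  assumes "0 < e" "e < eH" "0 \<le> w" "w < w'"
  shows "T e w < T e w'"
proof (rule DERIV_pos_imp_increasing_open [OF \<open>w < w'\<close>])
  fix s assume "w < s" "s < w'"
  then show "\<exists>y. (T e has_real_derivative y) (at s) \<and> y > 0"
    using DERIV_T g_pos assms by (meson le_less_trans)
next
  show "continuous_on {w..w'} (T e)"
    by (rule continuous_on_compose2 [OF continuous_on_T, of _ "\<lambda>w. (e, w)", simplified])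
       (use assms in \<open>auto intro!: continuous_on_Pair continuous_on_const continuous_on_id\<close>)
qed

section \<open>Returning from w to the radius\<close>

definition P :: "real \<Rightarrow> real \<Rightarrow> real" where
  "P e x = (e - H * x ^ 3) / W x"

definition wcoord :: "real \<Rightarrow> real \<Rightarrow> real" where
  "wcoord e x = sqrt ((P e x)\<^sup>2 - 1)"

definition tau :: "real \<Rightarrow> real \<Rightarrow> real" where
  "tau e x = T e (wcoord e x)"

lemma K_P: "0 < x \<Longrightarrow> x < 2 * M \<Longrightarrow> K (P e x) x = e"
  using W_pos [of x] by (simp add: K_def P_def)

lemma P_ge_1: "0 < x \<Longrightarrow> x < 2 * M \<Longrightarrow> K 1 x \<le> e \<Longrightarrow> 1 \<le> P e x"
  using W_pos [of x] by (simp add: K_def P_def field_simps)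

lemma P_gt_1: "0 < x \<Longrightarrow> x < 2 * M \<Longrightarrow> K 1 x < e \<Longrightarrow> 1 < P e x"
  using W_pos [of x] by (simp add: K_def P_def field_simps)

lemma DERIV_P:
  assumes "0 < x" "x < 2 * M"
  shows "(P e has_real_derivative - (x\<^sup>2 * (3 * H + P e x * R x) / W x)) (at x)"
proof -
  have pos: "W x > 0" using assms by (rule W_pos)
  have "((\<lambda>x. (e - H * x ^ 3) / W x) has_real_derivative
      ((- (H * (3 * x\<^sup>2))) * W x - (e - H * x ^ 3) * (x\<^sup>2 * R x)) / (W x * W x)) (at x)"
    by (rule derivative_eq_intros DERIV_W assms refl | use pos in simp)+
  moreover have "((- (H * (3 * x\<^sup>2))) * W x - (e - H * x ^ 3) * (x\<^sup>2 * R x)) / (W x * W x)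
      = - (x\<^sup>2 * (3 * H + P e x * R x) / W x)"
    using pos by (simp add: P_def field_simps)
  ultimately show ?thesis by (simp only: P_def [abs_def])
qed

lemma wcoord_sq:
  assumes "0 < x" "x < 2 * M" "K 1 x \<le> e"
  shows "(wcoord e x)\<^sup>2 = (P e x)\<^sup>2 - 1"
  using P_ge_1 [OF assms] by (simp add: wcoord_def)

lemma wcoord_nonneg:
  assumes "0 < x" "x < 2 * M" "K 1 x \<le> e"
  shows "wcoord e x \<ge> 0"
  using P_ge_1 [OF assms] by (simp add: wcoord_def)

lemma wcoord_pos:
  assumes "0 < x" "x < 2 * M" "K 1 x < e"
  shows "wcoord e x > 0"
  using P_gt_1 [OF assms] by (simp add: wcoord_def)

lemma DERIV_wcoord:
  assumes "0 < x" "x < 2 * M" "K 1 x < e"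
  shows "(wcoord e has_real_derivative
           - (P e x / wcoord e x * (x\<^sup>2 * (3 * H + P e x * R x) / W x))) (at x)"
proof -
  let ?P' = "- (x\<^sup>2 * (3 * H + P e x * R x) / W x)"
  have pos: "0 < (P e x)\<^sup>2 - 1" using P_gt_1 [OF assms] by simp
  have "((\<lambda>x. (P e x)\<^sup>2 - 1) has_real_derivative 2 * (P e x * ?P')) (at x)"
    by (rule derivative_eq_intros DERIV_P assms refl | simp)+
  from DERIV_chain2 [where f = sqrt and g = "\<lambda>x. (P e x)\<^sup>2 - 1",
      OF DERIV_real_sqrt [OF pos] this]
  have "(wcoord e has_real_derivative inverse (wcoord e x) / 2 * (2 * (P e x * ?P'))) (at x)"
    by (simp only: wcoord_def [abs_def])
  moreover have "inverse (wcoord e x) / 2 * (2 * (P e x * ?P')) =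
      - (P e x / wcoord e x * (x\<^sup>2 * (3 * H + P e x * R x) / W x))"
    by (simp add: inverse_eq_divide)
  ultimately show ?thesis by (simp only:)
qed

text \<open>Both substitutions are undone: \<open>sqrt (1 + w\<^sup>2)\<close> returns
  \<open>P e x\<close> because \<open>P e x\<close> is at least \<open>1\<close>, and
  \<open>X\<close> then returns \<open>x\<close> because \<open>K (P e x) x = e\<close>.\<close>

lemma g_wcoord:
  assumes "0 < x" "x < rH" "K 1 x \<le> e" "e < eH"
  shows "g e (wcoord e x) = G (P e x) x"
proof -
  have x: "x < 2 * M" using assms rH_props by simp
  have P: "1 \<le> P e x" using P_ge_1 assms x by simp
  then have "sqrt (1 + (wcoord e x)\<^sup>2) = P e x"
    using wcoord_sq assms x by simp
  moreover have "X (P e x) e = x"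
    using X_eqI K_P P assms x by simp
  ultimately show ?thesis by (simp add: g_def)
qed

lemma sq_div_W: "0 < x \<Longrightarrow> x < 2 * M \<Longrightarrow> x\<^sup>2 / W x = sqrt (x / (2 * M - x))"
proof -
  assume x: "0 < x" "x < 2 * M"
  have "(x\<^sup>2)\<^sup>2 = x ^ 3 * x" by algebra
  then have "(x\<^sup>2 / W x)\<^sup>2 = x ^ 3 * x / (x ^ 3 * (2 * M - x))"
    by (simp only: power_divide W_sq [OF x])
  also have "\<dots> = x / (2 * M - x)" using x by simp
  finally have "x / (2 * M - x) = (x\<^sup>2 / W x)\<^sup>2" ..
  then show ?thesis using W_pos [OF x] by simp
qed

lemma K_1_pos: "0 < x \<Longrightarrow> x \<le> rH \<Longrightarrow> 0 < K 1 x"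
  using K_1_less [of 0 x] by simp

text \<open>With \<open>p = P e x\<close> and \<open>w = wcoord e x\<close> one has w dw = p dp. The
  slope factor in dp cancels the denominator of \<open>G\<close>, and the remaining factors multiply
  to \<open>x / (2 * M - x)\<close> because \<open>x\<^sup>2 / W x\<close> equals
  \<open>sqrt (x / (2 * M - x))\<close>.\<close>

lemma DERIV_tau:
  assumes "0 < x" "x < rH" "K 1 x < e" "e < eH"
  shows "(tau e has_real_derivative - (x / (2 * M - x) * (P e x / wcoord e x))) (at x)"
proof -
  have x: "x < 2 * M" using assms rH_props by simp
  have e: "0 < e" using K_1_pos [of x] assms by simp
  have slope: "3 * H + P e x * R x > 0"
    using slope_pos [of x "P e x"] P_ge_1 [of x e] K_P [of x e] assms x by simp
  have "(tau e has_real_derivative g e (wcoord e x) *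
      - (P e x / wcoord e x * (x\<^sup>2 * (3 * H + P e x * R x) / W x))) (at x)"
    unfolding tau_def using assms x e
    by (intro DERIV_chain2 [where f = "T e" and g = "wcoord e"] DERIV_T DERIV_wcoord wcoord_pos)
  moreover have "g e (wcoord e x) *
      - (P e x / wcoord e x * (x\<^sup>2 * (3 * H + P e x * R x) / W x)) =
      - (sqrt (x / (2 * M - x)) * (x\<^sup>2 / W x) * (P e x / wcoord e x))"
    using slope g_wcoord [of x e] assms by (simp add: G_def mult_ac)
  moreover have "sqrt (x / (2 * M - x)) * (x\<^sup>2 / W x) = x / (2 * M - x)"
    using assms x by (simp add: sq_div_W)
  ultimately show ?thesis by (simp only:)
qed

lemma tau_boundary: "0 < x \<Longrightarrow> x < 2 * M \<Longrightarrow> tau (K 1 x) x = 0"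
  using W_pos [of x] by (simp add: tau_def wcoord_def P_def K_def)

text \<open>The domain includes the boundary \<open>K 1 x = e\<close>, which
  \<open>DERIV_tau\<close> excludes. Continuity there supplies the endpoint limit of the height
  integral and the starting value for the intermediate value theorem in \<open>e\<close>.\<close>

lemma continuous_on_tau:
  "continuous_on {z. fst z < eH \<and> 0 < snd z \<and> snd z < rH \<and> K 1 (snd z) \<le> fst z}
     (\<lambda>z. tau (fst z) (snd z))"
proof -
  let ?D = "{z. fst z < eH \<and> 0 < snd z \<and> snd z < rH \<and> K 1 (snd z) \<le> fst z}"
  have W: "continuous_on ?D (\<lambda>z. W (snd z))"
    by (rule continuous_on_compose2 [OF continuous_on_W [of UNIV] continuous_on_snd])
       (auto intro: continuous_on_id)
  have "W (snd z) \<noteq> 0" if "z \<in> ?D" for z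
    using W_pos [of "snd z"] rH_props that by auto
  then have "continuous_on ?D (\<lambda>z. wcoord (fst z) (snd z))"
    unfolding wcoord_def P_def
    by (intro continuous_on_real_sqrt continuous_on_diff continuous_on_power continuous_on_divide
        continuous_on_mult continuous_on_const continuous_on_fst continuous_on_snd
        continuous_on_id W ballI)
  then have "continuous_on ?D (\<lambda>z. (fst z, wcoord (fst z) (snd z)))"
    by (intro continuous_on_Pair continuous_on_fst continuous_on_id)
  moreover have "(fst z, wcoord (fst z) (snd z)) \<in> {0<..<eH} \<times> {0..}" if "z \<in> ?D" for z
    using that wcoord_nonneg [of "snd z" "fst z"] K_1_pos [of "snd z"] rH_props by auto
  ultimately have "continuous_on ?D
      (\<lambda>z. T (fst (fst z, wcoord (fst z) (snd z))) (snd (fst z, wcoord (fst z) (snd z))))"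
    by (intro continuous_on_compose2 [OF continuous_on_T]) auto
  then show ?thesis by (simp add: tau_def)
qed

lemma continuous_on_tau_x:
  assumes "e < eH" "\<And>x. x \<in> A \<Longrightarrow> 0 < x \<and> x < rH \<and> K 1 x \<le> e"
  shows "continuous_on A (tau e)"
proof -
  have "continuous_on A (\<lambda>x. (e, x))"
    by (intro continuous_on_Pair continuous_on_const continuous_on_id)
  moreover have "(\<lambda>x. (e, x)) ` A \<subseteq>
      {z. fst z < eH \<and> 0 < snd z \<and> snd z < rH \<and> K 1 (snd z) \<le> fst z}"
    using assms by auto
  ultimately show ?thesis
    using continuous_on_compose2 [OF continuous_on_tau] by fastforce
qed

lemma continuous_on_tau_e:
  assumes "0 < x" "x < rH"
  shows "continuous_on {K 1 x..<eH} (\<lambda>e. tau e x)"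
proof -
  have "continuous_on {K 1 x..<eH} (\<lambda>e. (e, x))"
    by (intro continuous_on_Pair continuous_on_const continuous_on_id)
  moreover have "(\<lambda>e. (e, x)) ` {K 1 x..<eH} \<subseteq>
      {z. fst z < eH \<and> 0 < snd z \<and> snd z < rH \<and> K 1 (snd z) \<le> fst z}"
    using assms by auto
  ultimately show ?thesis
    using continuous_on_compose2 [OF continuous_on_tau] by fastforce
qed

text \<open>Raising \<open>e\<close> raises the integrand and the upper limit. The limit grows
  strictly, so the result is strict even when \<open>K 1 x = e\<close> and the smaller integral is
  over a single point.\<close>

lemma tau_strict_mono_e:
  assumes "0 < x" "x < rH" "K 1 x \<le> e" "e < e'" "e' < eH"
  shows "tau e x < tau e' x"
proof -
  have x: "x < 2 * M" using assms rH_props by simp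
  have e: "0 < e" using K_1_pos [of x] assms by simp
  have P: "1 \<le> P e x" using assms x by (intro P_ge_1)
  have "P e x < P e' x"
    using assms W_pos [OF assms(1) x] by (simp add: P_def divide_strict_right_mono)
  with P have "(P e x)\<^sup>2 < (P e' x)\<^sup>2" by (intro power_strict_mono) auto
  then have "wcoord e x < wcoord e' x" by (simp add: wcoord_def)
  moreover have "0 \<le> wcoord e x" using assms x by (intro wcoord_nonneg)
  ultimately have "T e' (wcoord e x) < T e' (wcoord e' x)"
    using assms e by (intro T_strict_mono_w) auto
  moreover have "T e (wcoord e x) \<le> T e' (wcoord e x)"
    using assms e by (intro T_mono_e)
  ultimately show ?thesis by (simp add: tau_def)
qed

lemma integrand_eq:
  assumes "0 < x" "x < 2 * M" "K 1 x < e"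
  shows "x / (x - 2 * M) * ((- H * x ^ 3 - (- e)) /
           sqrt ((H * x ^ 3 + (- e))\<^sup>2 + x ^ 3 * (x - 2 * M)))
       = - (x / (2 * M - x) * (P e x / wcoord e x))"
proof -
  have W: "W x > 0" using assms by (simp add: W_pos)
  \<comment> \<open>Here \<open>x ^ 3 * (x - 2 * M)\<close> is \<open>- (W x)\<^sup>2\<close>, so
    the radicand is \<open>(W x)\<^sup>2 * ((P e x)\<^sup>2 - 1)\<close>.\<close>
  have "(H * x ^ 3 + (- e))\<^sup>2 + x ^ 3 * (x - 2 * M) = (e - H * x ^ 3)\<^sup>2 - (W x)\<^sup>2"
    unfolding W_sq [OF assms(1,2)] by algebra
  also have "\<dots> = (W x * wcoord e x)\<^sup>2"
    using wcoord_sq [of x e] W assms by (simp add: P_def power_mult_distrib field_simps)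
  finally have "sqrt ((H * x ^ 3 + (- e))\<^sup>2 + x ^ 3 * (x - 2 * M)) = W x * wcoord e x"
    using W wcoord_nonneg [of x e] assms by (simp add: real_sqrt_unique)
  moreover have "x / (x - 2 * M) = - (x / (2 * M - x))"
    using assms by (simp add: field_simps)
  ultimately show ?thesis by (simp add: P_def)
qed

lemma f_height_eq:
  assumes c: "c_min M H < c" "c < 0" and r: "0 < r" "r \<le> r_minus M H c"
  shows "f_height M H c r = tau (- c) r"
proof -
  define e where "e = - c"
  have e: "0 < e" "e < eH" using c by (auto simp: e_def c_min_eq)
  define b where "b = X 1 e"
  have rm: "r_minus M H c = b" using c by (simp add: r_minus_eq b_def e_def)
  have b: "0 < b" "b < rH" "b < 2 * M" "K 1 b = e"
    using X_props [of 1 e] X_less_2M [of 1 e] e by (auto simp: b_def)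
  have tb: "tau e b = 0" using tau_boundary [of b] b by simp
  let ?f = "\<lambda>x. x / (2 * M - x) * (P e x / wcoord e x)"
  have in_dom: "0 < x" "x < rH" "x < 2 * M" "K 1 x < e" if "r < x" "x < b" for x
    using that r b rH_props K_1_less [of x b] by auto
  show ?thesis
  proof (cases "r = b")
    case True
    then show ?thesis using tb by (simp add: f_height_def rm e_def)
  next
    case False
    then have "r < b" using r rm by simp
    have cont: "continuous_on {r..b} (\<lambda>x. - tau e x)"
      by (intro continuous_on_minus continuous_on_tau_x)
         (use e r b K_1_less [of _ b] in \<open>force simp: le_less\<close>)+
    have "f_height M H c r = (LBINT x=ereal b..ereal r. - ?f x)"
      unfolding f_height_def rm
    proof (rule interval_integral_cong)
      fix x assume "x \<in> einterval (min (ereal b) (ereal r)) (max (ereal b) (ereal r))"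
      then have "r < x" "x < b" using \<open>r < b\<close> by (auto simp: einterval_iff min_def max_def)
      from integrand_eq [OF in_dom(1,3,4) [OF this]]
      show "x / (x - 2 * M) * ((- H * x ^ 3 - c) / sqrt ((H * x ^ 3 + c)\<^sup>2 + x ^ 3 * (x - 2 * M)))
        = - ?f x" by (simp add: e_def)
    qed
    also have "\<dots> = (LBINT x=ereal r..ereal b. ?f x)"
      by (simp add: interval_lebesgue_integral_uminus interval_integral_endpoints_reverse [of b r])
    also have "\<dots> = 0 - (- tau e r)"
    \<comment> \<open>The integrand blows up at \<open>b\<close>. This improper form for nonnegative
      integrands asks at the endpoints only for limits of the antiderivative
      \<open>- tau e\<close>.\<close>
    proof (rule interval_integral_FTC_nonneg)
      show "ereal r < ereal b" using \<open>r < b\<close> by simp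
      fix x assume "ereal r < ereal x" "ereal x < ereal b"
      then have x: "r < x" "x < b" by auto
      from in_dom [OF this] e have "((\<lambda>x. - tau e x) has_real_derivative - (- ?f x)) (at x)"
        by (intro DERIV_minus DERIV_tau)
      then show "((\<lambda>x. - tau e x) has_real_derivative ?f x) (at x)" by (simp only: minus_minus)
      have "isCont (P e) x" "isCont (wcoord e) x"
        using in_dom [OF x] DERIV_P DERIV_wcoord DERIV_isCont by blast+
      then show "isCont ?f x"
        using in_dom [OF x] wcoord_pos [of x e] by (intro continuous_intros) auto
    next
      show "AE x in lborel. ereal r < ereal x \<longrightarrow> ereal x < ereal b \<longrightarrow> 0 \<le> ?f x"
      proof (intro AE_I2 impI)
        fix x assume "ereal r < ereal x" "ereal x < ereal b"
        then have x: "r < x" "x < b" by auto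
        from in_dom [OF this] show "0 \<le> ?f x"
          using P_gt_1 [of x e] wcoord_pos [of x e] by simp
      qed
      have "((\<lambda>x. - tau e x) \<longlongrightarrow> - tau e r) (at_right r)"
        using cont \<open>r < b\<close> by (rule continuous_on_Icc_at_rightD)
      then show "(((\<lambda>x. - tau e x) \<circ> real_of_ereal) \<longlongrightarrow> - tau e r) (at_right (ereal r))"
        by (simp only: ereal_tendsto_simps)
      have "((\<lambda>x. - tau e x) \<longlongrightarrow> - tau e b) (at_left b)"
        using cont \<open>r < b\<close> by (rule continuous_on_Icc_at_leftD)
      then show "(((\<lambda>x. - tau e x) \<circ> real_of_ereal) \<longlongrightarrow> 0) (at_left (ereal b))"
        by (simp only: ereal_tendsto_simps tb minus_zero)
    qed
    finally show ?thesis by (simp add: e_def)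
  qed
qed

section \<open>Divergence of the height at the minimal level\<close>

text \<open>The slope of \<open>K 1\<close> vanishes at \<open>rH\<close>. The mean value theorem
  for \<open>K 1\<close> and then for \<open>R\<close> yields one factor \<open>rH - x\<close> each,
  and the derivative of \<open>R\<close> is bounded on \<open>[r, rH]\<close>.\<close>

lemma eH_minus_K_le_quadratic:
  assumes r: "0 < r" "r < rH"
  obtains a where "a > 0" "\<And>x. r \<le> x \<Longrightarrow> x < rH \<Longrightarrow> eH - K 1 x \<le> a * (rH - x)\<^sup>2"
proof -
  define R' where "R' x = 2 / W x + (x * (3 * M - 2 * x))\<^sup>2 / W x ^ 3" for x
  have Wne: "W x > 0" if "x \<in> {r..rH}" for x
    using that r rH_props by (intro W_pos) auto
  have "continuous_on {r..rH} R'"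
    unfolding R'_def using Wne
    by (intro continuous_on_add continuous_on_divide continuous_on_power continuous_on_mult
        continuous_on_diff continuous_on_const continuous_on_id continuous_on_W ballI)
      (metis less_irrefl power_not_zero)+
  from compact_imp_bounded [OF compact_continuous_image [OF this compact_Icc]]
  obtain B where "B > 0" and B: "\<And>x. x \<in> {r..rH} \<Longrightarrow> R' x \<le> B"
    unfolding bounded_pos by (fastforce simp: abs_le_iff)
  show thesis
  proof
    show "rH\<^sup>2 * B > 0" using \<open>B > 0\<close> rH_props by simp
    fix x assume x: "r \<le> x" "x < rH"
    have dK: "(K 1 has_real_derivative s\<^sup>2 * (3 * H + 1 * R s)) (at s)" if "x \<le> s" "s \<le> rH" for s
      using that x r rH_props by (intro DERIV_K) auto
    from MVT2 [OF x(2) this] obtain s where s: "x < s" "s < rH"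
      and eq: "eH - K 1 x = (rH - x) * (s\<^sup>2 * (3 * H + R s))" by auto
    have "(R has_real_derivative - R' t) (at t)" if "s \<le> t" "t \<le> rH" for t
      unfolding R'_def using that x s r rH_props by (intro DERIV_R) auto
    from MVT2 [OF s(2) this] obtain t where t: "s < t" "t < rH"
      and eq': "R rH - R s = (rH - s) * - R' t" by auto
    have "3 * H + R s = (rH - s) * R' t" using eq' rH_props(3) by simp
    also have "\<dots> \<le> (rH - x) * B"
      using B [of t] s t x \<open>B > 0\<close> by (intro mult_mono') (auto simp: R'_def Wne less_imp_le)
    finally have "s\<^sup>2 * (3 * H + R s) \<le> s\<^sup>2 * ((rH - x) * B)"
      by (intro mult_left_mono) auto
    also have "\<dots> \<le> rH\<^sup>2 * ((rH - x) * B)"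
      using s x r \<open>B > 0\<close> by (intro mult_right_mono power_mono) auto
    finally have "eH - K 1 x \<le> (rH - x) * (rH\<^sup>2 * ((rH - x) * B))"
      unfolding eq using x by (intro mult_left_mono) auto
    then show "eH - K 1 x \<le> rH\<^sup>2 * B * (rH - x)\<^sup>2"
      by (simp add: power2_eq_square mult_ac)
  qed
qed

text \<open>The bound is uniform in \<open>e\<close>: with p and w as before, w squared is
  \<open>(p + 1) * (p - 1)\<close>, where \<open>p + 1\<close> is at most
  \<open>2 * p\<^sup>2\<close> and \<open>p - 1 = (e - K 1 x) / W x\<close> is quadratically small
  in \<open>rH - x\<close> since \<open>e < eH\<close>.\<close>

lemma speed_lower_bound:
  assumes r: "0 < r" "r < rH"
  obtains C where "C > 0"
    "\<And>e x. r \<le> x \<Longrightarrow> x < rH \<Longrightarrow> K 1 x < e \<Longrightarrow> e < eH \<Longrightarrow>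
       C / (rH - x) \<le> x / (2 * M - x) * (P e x / wcoord e x)"
proof -
  obtain a where a: "a > 0" and quad: "\<And>x. r \<le> x \<Longrightarrow> x < rH \<Longrightarrow> eH - K 1 x \<le> a * (rH - x)\<^sup>2"
    using eH_minus_K_le_quadratic [OF r] by blast
  have r2: "r < 2 * M" using r rH_props by simp
  \<comment> \<open>\<open>m\<close> is a lower bound for \<open>W\<close> on
    \<open>[r, rH)\<close>, and \<open>q\<^sup>2 = 2 * a / m\<close> collects the constants.\<close>
  define m where "m = sqrt (r ^ 3 * (2 * M - rH))"
  have m: "m > 0" using r rH_props by (simp add: m_def)
  define q where "q = sqrt (2 * a / m)"
  have q: "q > 0" using a m by (simp add: q_def)
  show thesis
  proof
    show "r / (2 * M) / q > 0" using r q M_pos by simp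
    fix e x assume x: "r \<le> x" "x < rH" and e: "K 1 x < e" "e < eH"
    have x': "0 < x" "x < 2 * M" using x r rH_props by auto
    have "m \<le> W x"
      unfolding m_def W_def using x r rH_props
      by (intro real_sqrt_le_mono mult_mono power_mono) auto
    have P: "P e x > 1" using x' e by (intro P_gt_1)
    have "P e x - 1 = (e - K 1 x) / W x"
      using W_pos [OF x'] by (simp add: P_def K_def field_simps)
    also have "\<dots> \<le> a * (rH - x)\<^sup>2 / m"
      using quad [OF x] e m \<open>m \<le> W x\<close> a by (intro frac_le) auto
    finally have P': "P e x - 1 \<le> a / m * (rH - x)\<^sup>2" by simp
    have "(wcoord e x)\<^sup>2 = (P e x + 1) * (P e x - 1)"
      using wcoord_sq [of x e] x' e by (simp add: algebra_simps power2_eq_square)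
    also have "\<dots> \<le> (2 * (P e x)\<^sup>2) * (a / m * (rH - x)\<^sup>2)"
    proof (rule mult_mono [OF _ P'])
      have "P e x * 1 \<le> P e x * P e x" using P by (intro mult_left_mono) auto
      then show "P e x + 1 \<le> 2 * (P e x)\<^sup>2" unfolding power2_eq_square using P by linarith
    qed (use P in auto)
    also have "\<dots> = (P e x * (q * (rH - x)))\<^sup>2"
      using a m by (simp add: q_def power_mult_distrib)
    finally have "wcoord e x \<le> P e x * (q * (rH - x))"
      by (rule power2_le_imp_le) (use P q x in simp)
    then have "1 / q / (rH - x) \<le> P e x / wcoord e x"
      using wcoord_pos [OF x' e(1)] q x by (simp add: field_simps)
    moreover have "r / (2 * M) \<le> x / (2 * M - x)"
      using x x' r by (intro frac_le) auto
    ultimately have "r / (2 * M) * (1 / q / (rH - x)) \<le> x / (2 * M - x) * (P e x / wcoord e x)"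
      using x x' q by (intro mult_mono) auto
    then show "r / (2 * M) / q / (rH - x) \<le> x / (2 * M - x) * (P e x / wcoord e x)"
      by simp
  qed
qed

lemma tau_unbounded:
  assumes r: "0 < r" "r < rH"
  shows "\<exists>e. K 1 r < e \<and> e < eH \<and> B \<le> tau e r"
proof -
  obtain C where C: "C > 0" and speed:
    "\<And>e x. r \<le> x \<Longrightarrow> x < rH \<Longrightarrow> K 1 x < e \<Longrightarrow> e < eH \<Longrightarrow>
       C / (rH - x) \<le> x / (2 * M - x) * (P e x / wcoord e x)"
    using speed_lower_bound [OF r] by blast
  \<comment> \<open>The level \<open>K 1 b\<close> makes the height vanish at \<open>b\<close>. The
    speed bound forces it to grow by at least \<open>C * ln ((rH - r) / (rH - b))\<close> from
    \<open>b\<close> down to \<open>r\<close>, and \<open>d\<close> makes this equal to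
    \<open>abs B + 1\<close>.\<close>
  define d where "d = (rH - r) * exp (- ((\<bar>B\<bar> + 1) / C))"
  define b where "b = rH - d"
  have "exp (- ((\<bar>B\<bar> + 1) / C)) < 1" using C by (simp add: divide_pos_pos)
  then have d: "0 < d" "d < rH - r" using r by (auto simp: d_def)
  then have b: "r < b" "b < rH" by (auto simp: b_def)
  define e where "e = K 1 b"
  have e: "K 1 r < e" "e < eH" using K_1_less [of r b] K_1_less [of b rH] b r by (auto simp: e_def)
  let ?h = "\<lambda>x. tau e x - C * ln (rH - x)"
  have lt: "K 1 x < e" if "r \<le> x" "x < b" for x
    using K_1_less [of x b] that b r by (simp add: e_def)
  have "?h b \<le> ?h r"
  proof (rule DERIV_nonpos_imp_decreasing_open [where f = ?h])
    show "r \<le> b" using b by simp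
    fix x assume x: "r < x" "x < b"
    have "(?h has_real_derivative
        - (x / (2 * M - x) * (P e x / wcoord e x)) - C * (inverse (rH - x) * (0 - 1))) (at x)"
      using x r b e lt
      by (intro DERIV_diff DERIV_tau DERIV_cmult DERIV_chain2 [where f = ln] DERIV_ln DERIV_const
          DERIV_ident) auto
    moreover have "- (x / (2 * M - x) * (P e x / wcoord e x)) - C * (inverse (rH - x) * (0 - 1)) \<le> 0"
      using speed [of x e] lt [of x] x b e by (simp add: divide_inverse)
    ultimately show "\<exists>y. (?h has_real_derivative y) (at x) \<and> y \<le> 0" by blast
  next
    show "continuous_on {r..b} ?h"
    proof (intro continuous_on_diff continuous_on_mult continuous_on_const continuous_on_ln
        continuous_on_id continuous_on_tau_x e(2))
      fix x assume x: "x \<in> {r..b}"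
      then have "K 1 x \<le> e" using lt [of x] by (cases "x = b") (auto simp: e_def)
      with x b r show "0 < x \<and> x < rH \<and> K 1 x \<le> e" by auto
    qed (use b in auto)
  qed
  moreover have "tau e b = 0"
    unfolding e_def using b r rH_props by (intro tau_boundary) auto
  moreover have "ln (rH - b) = ln (rH - r) - (\<bar>B\<bar> + 1) / C"
    using r by (simp add: b_def d_def ln_mult)
  then have "C * ln (rH - b) = C * ln (rH - r) - (\<bar>B\<bar> + 1)"
    using C by (simp add: right_diff_distrib)
  ultimately have "\<bar>B\<bar> + 1 \<le> tau e r" by linarith
  with e show ?thesis by (intro exI [of _ e]) auto
qed

lemma tau_surj:
  assumes r: "0 < r" "r < rH" and "t \<ge> 0"
  shows "\<exists>e. K 1 r \<le> e \<and> e < eH \<and> tau e r = t"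
proof -
  obtain e' where e': "K 1 r < e'" "e' < eH" "t \<le> tau e' r"
    using tau_unbounded [OF r] by blast
  have "tau (K 1 r) r = 0" using r rH_props by (intro tau_boundary) auto
  then have "\<exists>e\<ge>K 1 r. e \<le> e' \<and> tau e r = t"
    using e' \<open>t \<ge> 0\<close>
    by (intro IVT' continuous_on_subset [OF continuous_on_tau_e [OF r]]) auto
  with e' show ?thesis by auto
qed

lemma tau_nonneg:
  assumes "0 < r" "r < rH" "K 1 r \<le> e" "e < eH"
  shows "0 \<le> tau e r"
  using tau_strict_mono_e [of r "K 1 r" e] tau_boundary [of r] assms rH_props
  by (cases "K 1 r = e") auto

section \<open>Static coordinates on region II\<close>

text \<open>This gives uniqueness in \<open>area_radius\<close>. Comparison with the value
  \<open>- 2 * M\<close> at \<open>0\<close> also places the points of the static chart in the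
  Kruskal domain.\<close>

lemma kruskal_radius_less:
  assumes "0 \<le> x" "x < y"
  shows "(x - 2 * M) * exp (x / (2 * M)) < (y - 2 * M) * exp (y / (2 * M))"
proof (rule DERIV_pos_imp_increasing_open [OF \<open>x < y\<close>])
  fix z assume "x < z" "z < y"
  with assms have "z > 0" by simp
  have "((\<lambda>x. (x - 2 * M) * exp (x / (2 * M))) has_real_derivative
      z / (2 * M) * exp (z / (2 * M))) (at z)"
    using M_pos by (auto intro!: derivative_eq_intros simp: field_simps)
  moreover have "z / (2 * M) * exp (z / (2 * M)) > 0" using M_pos \<open>z > 0\<close> by simp
  ultimately show "\<exists>d. ((\<lambda>x. (x - 2 * M) * exp (x / (2 * M))) has_real_derivative d) (at z) \<and> d > 0"
    by blast
qed (use M_pos in \<open>auto intro!: continuous_intros\<close>)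

text \<open>This inverts the chart \<open>(r, t)\<close> of region II with
  \<open>t = 2 * M * ln \<bar>V / U\<bar>\<close>. Putting the height for \<open>t\<close> gives
  \<open>U_curve\<close> and \<open>V_curve\<close> literally.\<close>

definition point :: "real \<Rightarrow> real \<Rightarrow> real \<times> real" where
  "point r t = (- exp (- (1 / (4 * M)) * (t - r - 2 * M * ln \<bar>r - 2 * M\<bar>)),
                exp (1 / (4 * M) * (t + r + 2 * M * ln \<bar>r - 2 * M\<bar>)))"

lemma T_refl_point: "T_refl (point r t) = point r (- t)"
  by (simp add: T_refl_def point_def algebra_simps)

lemma point_product:
  assumes "r < 2 * M"
  shows "fst (point r t) * snd (point r t) = (r - 2 * M) * exp (r / (2 * M))"
proof -
  have "fst (point r t) * snd (point r t) =
      - exp (- (1 / (4 * M)) * (t - r - 2 * M * ln \<bar>r - 2 * M\<bar>)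
             + 1 / (4 * M) * (t + r + 2 * M * ln \<bar>r - 2 * M\<bar>))"
    by (simp only: point_def fst_conv snd_conv exp_add mult_minus_left)
  also have "- (1 / (4 * M)) * (t - r - 2 * M * ln \<bar>r - 2 * M\<bar>)
             + 1 / (4 * M) * (t + r + 2 * M * ln \<bar>r - 2 * M\<bar>) = ln (2 * M - r) + r / (2 * M)"
    using M_pos assms by (simp add: field_simps)
  finally show ?thesis using assms by (simp add: exp_add algebra_simps)
qed

lemma area_radius_eqI:
  assumes "r > 0" "(r - 2 * M) * exp (r / (2 * M)) = fst p * snd p"
  shows "area_radius M p = r"
  unfolding area_radius_def case_prod_beta
proof (rule the_equality)
  fix s assume "0 < s \<and> (s - 2 * M) * exp (s / (2 * M)) = fst p * snd p"
  then show "s = r"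
    using kruskal_radius_less [of s r] kruskal_radius_less [of r s] assms by linarith
qed (use assms in simp)

lemma area_radius_point: "0 < r \<Longrightarrow> r < 2 * M \<Longrightarrow> area_radius M (point r t) = r"
  by (intro area_radius_eqI) (simp_all add: point_product)

lemma point_in_region_II:
  assumes "0 < r" "r < 2 * M"
  shows "point r t \<in> region_II M"
proof -
  have "fst (point r t) * snd (point r t) > - 2 * M"
    using kruskal_radius_less [of 0 r] assms point_product [of r t] by simp
  moreover have "fst (point r t) < 0" "snd (point r t) > 0" by (auto simp: point_def)
  ultimately show ?thesis by (simp add: region_II_def kruskal_def case_prod_beta)
qed

lemma point_inject:
  assumes "0 < r" "r < 2 * M" "0 < r'" "r' < 2 * M" "point r t = point r' t'"
  shows "r = r'" "t = t'"
proof -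
  show "r = r'" using assms area_radius_point by metis
  with assms(5) M_pos show "t = t'" by (simp add: point_def)
qed

lemma region_II_imp_point:
  assumes "p \<in> region_II M"
  obtains r t where "0 < r" "r < 2 * M" "p = point r t"
proof -
  obtain U V where p: "p = (U, V)" by (cases p)
  with assms have UV: "U < 0" "V > 0" "- 2 * M < U * V"
    by (auto simp: region_II_def kruskal_def)
  let ?k = "\<lambda>r. (r - 2 * M) * exp (r / (2 * M))"
  have neg: "U * V < 0" using UV by (simp add: mult_neg_pos)
  have "\<exists>r\<ge>0. r \<le> 2 * M \<and> ?k r = U * V"
    using UV M_pos neg by (intro IVT') (auto intro!: continuous_intros)
  then obtain r where r: "0 \<le> r" "r \<le> 2 * M" "?k r = U * V" by blast
  have "r \<noteq> 0" "r \<noteq> 2 * M" using r(3) UV neg by auto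
  with r have r': "0 < r" "r < 2 * M" by auto
  \<comment> \<open>The Schwarzschild time fixes the difference of \<open>ln V\<close> and
    \<open>ln (- U)\<close>; the logarithm of the equation for \<open>r\<close> fixes their
    sum.\<close>
  define t where "t = 2 * M * (ln V - ln (- U))"
  have "ln (- U) + ln V = ln (- U * V)" using UV ln_mult [of "- U" V] by simp
  also have "- U * V = (2 * M - r) * exp (r / (2 * M))" using r(3) by (simp add: algebra_simps)
  also have "ln \<dots> = ln (2 * M - r) + r / (2 * M)" using r' by (simp add: ln_mult)
  finally have eq: "2 * M * (ln (- U) + ln V) = r + 2 * M * ln (2 * M - r)"
    using M_pos by (simp add: field_simps)
  have "1 / (4 * M) * (t + r + 2 * M * ln \<bar>r - 2 * M\<bar>) =
      1 / (4 * M) * (t + 2 * M * (ln (- U) + ln V))"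
    using r' by (simp add: eq)
  also have "\<dots> = ln V" using M_pos by (simp add: t_def field_simps)
  finally have V: "1 / (4 * M) * (t + r + 2 * M * ln \<bar>r - 2 * M\<bar>) = ln V" .
  have "- (1 / (4 * M)) * (t - r - 2 * M * ln \<bar>r - 2 * M\<bar>) =
      - (1 / (4 * M)) * (t - 2 * M * (ln (- U) + ln V))"
    using r' by (simp add: eq)
  also have "\<dots> = ln (- U)" using M_pos by (simp add: t_def field_simps)
  finally have U: "- (1 / (4 * M)) * (t - r - 2 * M * ln \<bar>r - 2 * M\<bar>) = ln (- U)" .
  have "p = point r t" unfolding p point_def U V using UV by simp
  with r' that show thesis by blast
qed

section \<open>The leaves in static coordinates and the foliation\<close>

lemma Sigma_minus_eq:
  assumes c: "c_min M H < c" "c < 0"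
  shows "Sigma_minus M H c =
    {point r t |r t. 0 < r \<and> r < rH \<and> K 1 r \<le> - c \<and> \<bar>t\<bar> = tau (- c) r}"
proof -
  have e: "0 < - c" "- c < eH" using c by (auto simp: c_min_eq)
  have dom: "r \<in> {0<..r_minus M H c} \<longleftrightarrow> 0 < r \<and> r < rH \<and> K 1 r \<le> - c" for r
    using X_props [of 1 "- c"] X_less_iff [of 1 "- c" r] e c
    by (auto simp: r_minus_eq not_less [symmetric])
  \<comment> \<open>The height is nonnegative, so the curve and its reflection merge into one
    condition on \<open>\<bar>t\<bar>\<close>.\<close>
  have abs_t: "t = tau (- c) r \<or> t = - tau (- c) r \<longleftrightarrow> \<bar>t\<bar> = tau (- c) r"
    if "0 < r" "r < rH" "K 1 r \<le> - c" for r t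
    using tau_nonneg [OF that e(2)] by linarith
  have "half_curve M H c = (\<lambda>r. point r (tau (- c) r)) ` {0<..r_minus M H c}"
    unfolding half_curve_def
    by (intro image_cong refl) (simp add: U_curve_def V_curve_def point_def f_height_eq [OF c])
  then have "Sigma_minus M H c = (\<lambda>r. point r (tau (- c) r)) ` {0<..r_minus M H c} \<union>
      (\<lambda>r. point r (- tau (- c) r)) ` {0<..r_minus M H c}"
    by (simp only: Sigma_minus_def T_refl_point image_image)
  also have "\<dots> =
      {point r t |r t. r \<in> {0<..r_minus M H c} \<and> (t = tau (- c) r \<or> t = - tau (- c) r)}"
    by blast
  also have "\<dots> = {point r t |r t. 0 < r \<and> r < rH \<and> K 1 r \<le> - c \<and> \<bar>t\<bar> = tau (- c) r}"
    unfolding dom using abs_t by blast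
  finally show ?thesis .
qed

text \<open>A common point has one pair \<open>(r, t)\<close>, so \<open>\<bar>t\<bar>\<close> would
  be the height at \<open>r\<close> for two different levels, against strict monotonicity.\<close>

lemma disjoint_Sigma_minus:
  assumes c: "c_min M H < c" "c < c'" "c' < 0"
  shows "Sigma_minus M H c \<inter> Sigma_minus M H c' = {}"
proof (rule ccontr)
  assume "Sigma_minus M H c \<inter> Sigma_minus M H c' \<noteq> {}"
  then obtain p where "p \<in> Sigma_minus M H c" "p \<in> Sigma_minus M H c'" by blast
  moreover have "c < 0" "c_min M H < c'" using c by auto
  ultimately have "p \<in> {point r t |r t. 0 < r \<and> r < rH \<and> K 1 r \<le> - c \<and> \<bar>t\<bar> = tau (- c) r}"
    "p \<in> {point r t |r t. 0 < r \<and> r < rH \<and> K 1 r \<le> - c' \<and> \<bar>t\<bar> = tau (- c') r}"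
    using c Sigma_minus_eq by blast+
  then obtain r t r' t' where r: "p = point r t" "0 < r" "r < rH" "\<bar>t\<bar> = tau (- c) r"
    and r': "p = point r' t'" "0 < r'" "r' < rH" "K 1 r' \<le> - c'" "\<bar>t'\<bar> = tau (- c') r'"
    by blast
  have "r = r'" "t = t'" using point_inject [of r r' t t'] r r' rH_props by auto
  moreover have "tau (- c') r' < tau (- c) r'"
    using r' c by (intro tau_strict_mono_e) (auto simp: c_min_eq)
  ultimately show False using r r' by simp
qed

text \<open>To cover \<open>point r t\<close>, surjectivity of the height in \<open>e\<close> gives
  a level with height \<open>\<bar>t\<bar>\<close> at \<open>r\<close>;
  \<open>0 < K 1 r \<le> e < eH\<close> makes \<open>- e\<close> an admissible parameter.\<close>

lemma Union_Sigma_minus: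
  "(\<Union>c\<in>{c_min M H<..<0}. Sigma_minus M H c) =
     {p \<in> region_II M. 0 < area_radius M p \<and> area_radius M p < rH}"
proof (intro equalityI subsetI)
  fix p assume "p \<in> (\<Union>c\<in>{c_min M H<..<0}. Sigma_minus M H c)"
  then obtain r t where "p = point r t" "0 < r" "r < rH" by (auto simp: Sigma_minus_eq)
  then show "p \<in> {p \<in> region_II M. 0 < area_radius M p \<and> area_radius M p < rH}"
    using point_in_region_II [of r t] area_radius_point [of r t] rH_props by simp
next
  fix p assume p: "p \<in> {p \<in> region_II M. 0 < area_radius M p \<and> area_radius M p < rH}"
  then obtain r t where r: "0 < r" "r < 2 * M" "p = point r t"
    using region_II_imp_point by blast
  with p have "r < rH" by (simp add: area_radius_point)
  with r obtain e where e: "K 1 r \<le> e" "e < eH" "tau e r = \<bar>t\<bar>"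
    using tau_surj [of r "\<bar>t\<bar>"] by auto
  then have "0 < e" using K_1_pos [of r] r \<open>r < rH\<close> by simp
  with e have c: "- e \<in> {c_min M H<..<0}" by (simp add: c_min_eq)
  moreover have "p \<in> Sigma_minus M H (- e)"
  proof -
    have "p \<in> {point r t |r t. 0 < r \<and> r < rH \<and> K 1 r \<le> - (- e) \<and> \<bar>t\<bar> = tau (- (- e)) r}"
      using r e \<open>r < rH\<close> by (intro CollectI exI [of _ r] exI [of _ t]) simp
    then show ?thesis using c by (subst Sigma_minus_eq) (simp_all only: greaterThanLessThan_iff)
  qed
  ultimately show "p \<in> (\<Union>c\<in>{c_min M H<..<0}. Sigma_minus M H c)" by blast
qed

end

theorem theorem3p11:
  fixes M H :: real
  assumes "M > 0"
  shows "disjoint_family_on (Sigma_minus M H) {c_min M H<..<0} \<and>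
         (\<Union>c\<in>{c_min M H<..<0}. Sigma_minus M H c) =
           {p \<in> region_II M. 0 < area_radius M p \<and> area_radius M p < r_min M H}"
proof -
  interpret schwarzschild M H by standard (rule assms)
  have "Sigma_minus M H c \<inter> Sigma_minus M H c' = {}"
    if "c \<in> {c_min M H<..<0}" "c' \<in> {c_min M H<..<0}" "c \<noteq> c'" for c c'
    using disjoint_Sigma_minus [of c c'] disjoint_Sigma_minus [of c' c] that
    by (cases c c' rule: linorder_cases) (auto simp: Int_commute)
  then show ?thesis
    by (auto simp: disjoint_family_on_def Union_Sigma_minus)
qed

end
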